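(* Suppose $\alpha>0$. Then $$\dot J_\alpha(\theta)=-\alpha^2(2\alpha-1)^{-1}J_{\alpha-1}(\theta)\sin\theta,\qquad \dot{\mathbb J}_\alpha(c)=\alpha^2(2\alpha-1)^{-1}\,\mathbb J_{\alpha-1}(c),$$ where the dot denotes the derivative.
   Context: Put $\mathsf c_\alpha=\frac1{\sqrt\pi}2^{\alpha-1}\Gamma(\alpha+\frac12)$. For $\alpha>-1$, the kernel functions of the $\alpha$-ReLU ($x\mapsto x^\alpha$ for $x>0$, $0$ otherwise) are $$J_\alpha(\theta)=\frac1{2\pi\mathsf c_\alpha}(\sin\theta)^{2\alpha+1}\,\Gamma(\alpha+1)\int_0^{\pi/2}\frac{\cos^\alpha\eta}{(1-\cos\theta\cos\eta)^{1+\alpha}}\,d\eta ,\qquad \mathbb J_\alpha(c)=J_\alpha(\arccos c).$$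
   Formalization: At α = 1/2 the printed right-hand sides are undefined ((2α−1)^{-1} = 1/0 and c_{−1/2} involves Γ(0)), so there they are read as limits as α → 1/2; the derivatives are taken at interior points 0 < θ < π and −1 < c < 1. *)

theory Defs
  imports "HOL-Analysis.Analysis"
begin

definition relu_const :: "real \<Rightarrow> real" where
  "relu_const \<alpha> = 1 / sqrt pi * 2 powr (\<alpha> - 1) * Gamma (\<alpha> + 1 / 2)"

text \<open>
  The kernel functions of the \<open>\<alpha>\<close>-ReLU, meant for \<open>\<alpha> > -1\<close>, \<open>0 < \<theta> < pi\<close> and \<open>-1 < c < 1\<close>.
  There the integrand is nonnegative and integrable, so the Henstock--Kurzweil integral agrees
  with the (for \<open>\<alpha> < 0\<close> improper) Riemann and the Lebesgue integral. At \<open>\<theta> = 0\<close> the integral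
  diverges. At \<open>\<alpha> = -1/2\<close> the factor \<open>Gamma (\<alpha> + 1/2)\<close> has a pole, so the value there is only
  the junk value \<open>0\<close> coming from \<open>Gamma 0 = 0\<close> and \<open>x / 0 = 0\<close>.
\<close>

definition relu_J :: "real \<Rightarrow> real \<Rightarrow> real" where
  "relu_J \<alpha> \<theta> =
     1 / (2 * pi * relu_const \<alpha>) * sin \<theta> powr (2 * \<alpha> + 1) * Gamma (\<alpha> + 1) *
       integral {0..pi / 2}
         (\<lambda>\<eta>. cos \<eta> powr \<alpha> / (1 - cos \<theta> * cos \<eta>) powr (1 + \<alpha>))"

definition relu_JJ :: "real \<Rightarrow> real \<Rightarrow> real" where
  "relu_JJ \<alpha> c = relu_J \<alpha> (arccos c)"

end

theory Submission
  imports Defs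
begin

text \<open>
  Write \<open>I \<alpha> c\<close> for the integral in the definition of the kernel. Differentiation under the
  integral sign gives \<open>(1 + \<alpha>) * I (\<alpha> + 1) c\<close>, and integration by parts yields a three-term
  recurrence that trades \<open>I (\<alpha> + 1)\<close> for \<open>I (\<alpha> - 1)\<close>; the recurrence also shows that the
  singular integral \<open>I (\<alpha> - 1)\<close> is continuous in \<open>\<alpha> > 0\<close>. The factor \<open>2 * \<alpha> - 1\<close> comes from
  the functional equation of \<open>Gamma\<close> in the normalising constant and is absent from the
  unnormalised derivative, so the case \<open>\<alpha> = 1 / 2\<close> follows by continuity in \<open>\<alpha>\<close>.
\<close>

definition relu_integrand :: "real \<Rightarrow> real \<Rightarrow> real \<Rightarrow> real" where
  "relu_integrand \<alpha> c \<eta> = cos \<eta> powr \<alpha> / (1 - c * cos \<eta>) powr (1 + \<alpha>)"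

definition relu_integral :: "real \<Rightarrow> real \<Rightarrow> real" where
  "relu_integral \<alpha> c = integral {0..pi / 2} (relu_integrand \<alpha> c)"

definition relu_factor :: "real \<Rightarrow> real" where
  "relu_factor \<alpha> = 1 / (2 * pi * relu_const \<alpha>) * Gamma (\<alpha> + 1)"

text \<open>The derivative of \<open>relu_JJ\<close> with the normalising constant kept at
  \<open>\<alpha>\<close> instead of shifted to \<open>\<alpha> - 1\<close>. There is no division by
  \<open>2 * \<alpha> - 1\<close>, so the formula stays meaningful at
  \<open>\<alpha> = 1 / 2\<close>.\<close>

definition relu_JJ_deriv :: "real \<Rightarrow> real \<Rightarrow> real" where
  "relu_JJ_deriv \<alpha> c =
     relu_factor \<alpha> * (1 - c\<^sup>2) powr (\<alpha> - 1 / 2) * (\<alpha> * relu_integral (\<alpha> - 1) c)"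

section \<open>Regularity of the integrand and differentiation under the integral sign\<close>

lemma one_minus_mult_cos_pos:
  fixes c \<eta> :: real
  assumes "-1 < c" "c < 1"
  shows "0 < 1 - c * cos \<eta>"
proof -
  have "\<bar>c * cos \<eta>\<bar> \<le> \<bar>c\<bar> * 1"
    unfolding abs_mult by (intro mult_left_mono) auto
  with assms show ?thesis by linarith
qed

lemma one_minus_square_pos:
  fixes c :: real
  assumes "-1 < c" "c < 1"
  shows "0 < 1 - c\<^sup>2"
proof -
  have "0 < (1 - c) * (1 + c)" using assms by simp
  then show ?thesis by (simp add: power2_eq_square algebra_simps)
qed

text \<open>All three arguments vary, so that one rule serves integration in \<eta>, the Leibniz
  rule in \<open>c\<close> and continuity in the exponent. A positive exponent keeps
  \<open>powr\<close> continuous at \<open>pi / 2\<close>, where the cosine vanishes.\<close>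

lemma continuous_on_relu_integrand [continuous_intros]:
  fixes S :: "'a :: t2_space set"
  assumes "continuous_on S a" "continuous_on S c" "continuous_on S t"
    and "\<And>x. x \<in> S \<Longrightarrow> 0 < a x" "\<And>x. x \<in> S \<Longrightarrow> -1 < c x \<and> c x < 1"
    and "\<And>x. x \<in> S \<Longrightarrow> t x \<in> {0..pi / 2}"
  shows "continuous_on S (\<lambda>x. relu_integrand (a x) (c x) (t x))"
proof -
  have "0 \<le> cos (t x)" if "x \<in> S" for x
    using assms(6)[OF that] by (intro cos_ge_zero) auto
  moreover have cos: "continuous_on S (\<lambda>x. cos (t x))"
    using assms(3) by (rule continuous_on_cos)
  moreover have "1 - c x * cos (t x) \<noteq> 0" if "x \<in> S" for x
    using assms(5)[OF that] one_minus_mult_cos_pos[of "c x" "t x"] by auto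
  ultimately show ?thesis
    unfolding relu_integrand_def using assms(4)
    by (intro continuous_on_divide continuous_on_powr'[of S "\<lambda>x. cos (t x)"] continuous_on_powr
        continuous_on_diff continuous_on_add continuous_on_mult cos
        continuous_on_const assms(1,2)) auto
qed

lemma relu_integrand_integrable:
  assumes "0 < \<alpha>" "-1 < c" "c < 1"
  shows "relu_integrand \<alpha> c integrable_on {0..pi / 2}"
proof -
  have "continuous_on {0..pi / 2} (\<lambda>\<eta>. relu_integrand \<alpha> c \<eta>)"
    using assms by (intro continuous_intros) auto
  then show ?thesis by (rule integrable_continuous_real)
qed

text \<open>The inner derivative brings out a factor \<open>cos \<eta>\<close>, so the exponents of
  numerator and denominator both rise by one: the result is again a \<open>relu_integrand\<close>,
  with parameter \<open>\<alpha> + 1\<close>.\<close>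

lemma relu_integrand_has_derivative:
  assumes "-1 < c" "c < 1" "0 \<le> cos \<eta>"
  shows "((\<lambda>c. relu_integrand \<alpha> c \<eta>) has_real_derivative
           (1 + \<alpha>) * relu_integrand (\<alpha> + 1) c \<eta>) (at c)"
proof -
  have D: "0 < 1 - c * cos \<eta>" by (rule one_minus_mult_cos_pos) fact+
  have "((\<lambda>c. 1 - c * cos \<eta>) has_real_derivative - cos \<eta>) (at c)"
    by (auto intro!: derivative_eq_intros)
  from DERIV_cmult[OF DERIV_fun_powr[OF this D]]
  have "((\<lambda>c. cos \<eta> powr \<alpha> * (1 - c * cos \<eta>) powr (- 1 - \<alpha>)) has_real_derivative
           cos \<eta> powr \<alpha> * ((- 1 - \<alpha>) * (1 - c * cos \<eta>) powr (- 1 - \<alpha> - 1) * (- cos \<eta>))) (at c)"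
    by (rule DERIV_cong) simp
  moreover have "cos \<eta> powr (\<alpha> + 1) = cos \<eta> powr \<alpha> * cos \<eta>"
    using assms(3) by (cases "cos \<eta> = 0") (auto simp: powr_add)
  ultimately have "((\<lambda>c. cos \<eta> powr \<alpha> * (1 - c * cos \<eta>) powr (- 1 - \<alpha>)) has_real_derivative
           (1 + \<alpha>) * (cos \<eta> powr (\<alpha> + 1) * (1 - c * cos \<eta>) powr (- (\<alpha> + 2)))) (at c)"
    by (elim DERIV_cong) (auto simp: algebra_simps)
  moreover have "cos \<eta> powr \<alpha> * (1 - c * cos \<eta>) powr (- 1 - \<alpha>) = relu_integrand \<alpha> c \<eta>" for c
    using powr_minus_divide[of "1 - c * cos \<eta>" "1 + \<alpha>"] by (simp add: relu_integrand_def)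
  moreover have "cos \<eta> powr (\<alpha> + 1) * (1 - c * cos \<eta>) powr (- (\<alpha> + 2)) = relu_integrand (\<alpha> + 1) c \<eta>"
    unfolding powr_minus_divide relu_integrand_def by (simp add: add.commute)
  ultimately show ?thesis by simp
qed

lemma relu_integral_has_derivative:
  assumes "0 < \<alpha>" "-1 < c" "c < 1"
  shows "(relu_integral \<alpha> has_real_derivative (1 + \<alpha>) * relu_integral (\<alpha> + 1) c) (at c)"
proof -
  \<comment> \<open>The Leibniz rule works within a convex set of parameters; the interval chosen is
    also open, so the result is a full derivative at \<open>c\<close>.\<close>
  have "((\<lambda>c. integral (cbox 0 (pi / 2)) (relu_integrand \<alpha> c)) has_field_derivative
          integral (cbox 0 (pi / 2)) (\<lambda>\<eta>. (1 + \<alpha>) * relu_integrand (\<alpha> + 1) c \<eta>))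
         (at c within {-1<..<1})"
  proof (rule leibniz_rule_field_derivative)
    fix x t :: real
    assume x: "x \<in> {-1<..<1}" and t: "t \<in> cbox 0 (pi / 2)"
    have "0 \<le> cos t" using t by (intro cos_ge_zero) auto
    then show "((\<lambda>x. relu_integrand \<alpha> x t) has_field_derivative
            (1 + \<alpha>) * relu_integrand (\<alpha> + 1) x t) (at x within {-1<..<1})"
      using x by (intro DERIV_subset[OF relu_integrand_has_derivative]) auto
  next
    show "relu_integrand \<alpha> x integrable_on cbox 0 (pi / 2)" if "x \<in> {-1<..<1}" for x
      using relu_integrand_integrable[of \<alpha> x] assms that by simp
  next
    show "continuous_on ({-1<..<1} \<times> cbox 0 (pi / 2))
            (\<lambda>(x, t). (1 + \<alpha>) * relu_integrand (\<alpha> + 1) x t)"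
      unfolding case_prod_unfold using assms by (intro continuous_intros) auto
  qed (use assms in auto)
  moreover have "at c within {-1<..<1} = at c"
    using assms by (intro at_within_open) auto
  ultimately show ?thesis
    unfolding relu_integral_def[abs_def] by simp
qed

text \<open>
  The difference of the two sides is the integral of the derivative of
  \<open>sin \<eta> * relu_integrand \<alpha> c \<eta>\<close>, which vanishes at both ends of \<open>{0..pi / 2}\<close>.
\<close>

lemma relu_integral_recurrence:
  assumes "0 < \<alpha>" "-1 < c" "c < 1"
  shows "\<alpha> * relu_integral (\<alpha> - 1) c =
           (1 + \<alpha>) * (1 - c\<^sup>2) * relu_integral (\<alpha> + 1) c - (2 * \<alpha> + 1) * c * relu_integral \<alpha> c"
proof -
  let ?f = "\<lambda>\<eta>. (1 + \<alpha>) * (1 - c\<^sup>2) * relu_integrand (\<alpha> + 1) c \<eta> -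
              (2 * \<alpha> + 1) * c * relu_integrand \<alpha> c \<eta>"
  let ?g = "\<lambda>\<eta>. ?f \<eta> - \<alpha> * relu_integrand (\<alpha> - 1) c \<eta>"
  have "(?g has_integral
          (sin (pi / 2) * relu_integrand \<alpha> c (pi / 2) - sin 0 * relu_integrand \<alpha> c 0)) {0..pi / 2}"
  \<comment> \<open>For \<open>\<alpha> < 1\<close> the integrand with exponent
    \<open>\<alpha> - 1\<close> is unbounded near \<open>pi / 2\<close>. The interior version asks
    for the derivative on the open interval only, and for continuity of the antiderivative up to the
    ends.\<close>
  proof (rule fundamental_theorem_of_calculus_interior)
    show "continuous_on {0..pi / 2} (\<lambda>\<eta>. sin \<eta> * relu_integrand \<alpha> c \<eta>)"
      using assms by (intro continuous_intros) auto
  next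
    fix \<eta> :: real
    assume \<eta>: "\<eta> \<in> {0<..<pi / 2}"
    define x D where "x = cos \<eta>" and "D = 1 - c * x"
    have x: "0 < x" unfolding x_def using \<eta> by (intro cos_gt_zero) auto
    have D: "0 < D" unfolding D_def x_def by (rule one_minus_mult_cos_pos) fact+
    \<comment> \<open>\<open>A\<close> and \<open>B\<close> carry the lowest exponents that occur.
      The integrands for \<open>\<alpha> + 1\<close>, \<open>\<alpha>\<close> and
      \<open>\<alpha> - 1\<close> become \<open>A * B\<close> times \<open>x\<^sup>2\<close>,
      \<open>x * D\<close> and \<open>D\<^sup>2\<close>.\<close>
    define A where "A = x powr (\<alpha> - 1)"
    define B where "B = D powr (- (\<alpha> + 2))"
    have A: "x powr \<alpha> = A * x" "x powr (\<alpha> + 1) = A * x\<^sup>2"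
      using x by (auto simp: A_def powr_diff powr_add power2_eq_square)
    have B: "1 / D powr (1 + (\<alpha> + 1)) = B" "1 / D powr (1 + \<alpha>) = B * D"
      "1 / D powr (1 + (\<alpha> - 1)) = B * D\<^sup>2"
    proof -
      have *: "1 / D powr (\<alpha> + 2 - k) = B * D powr k" for k
        by (simp add: B_def algebra_simps flip: powr_add powr_minus_divide)
      show "1 / D powr (1 + (\<alpha> + 1)) = B" "1 / D powr (1 + \<alpha>) = B * D"
        "1 / D powr (1 + (\<alpha> - 1)) = B * D\<^sup>2"
        using *[of 0] *[of 1] *[of 2] D by (simp_all add: algebra_simps)
    qed
    have r: "relu_integrand (\<alpha> + 1) c \<eta> = A * x\<^sup>2 * B" "relu_integrand \<alpha> c \<eta> = A * x * (B * D)"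
      "relu_integrand (\<alpha> - 1) c \<eta> = A * (B * D\<^sup>2)"
      unfolding relu_integrand_def x_def[symmetric] D_def[symmetric]
      using A B A_def by (metis times_divide_eq_right mult.right_neutral)+
    have s: "sin \<eta> * sin \<eta> = 1 - x\<^sup>2"
      using sin_squared_eq[of \<eta>] by (simp add: x_def power2_eq_square)
    have "((\<lambda>\<eta>. 1 - c * cos \<eta>) has_real_derivative c * sin \<eta>) (at \<eta>)"
      by (auto intro!: derivative_eq_intros)
    note dD = DERIV_fun_powr[OF this D[unfolded D_def x_def]]
    note dx = DERIV_fun_powr[OF DERIV_cos x[unfolded x_def]]
    have "((\<lambda>\<eta>. sin \<eta> * (cos \<eta> powr \<alpha> * (1 - c * cos \<eta>) powr (- (1 + \<alpha>)))) has_real_derivative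
            x * (x powr \<alpha> * D powr (- (1 + \<alpha>))) +
            sin \<eta> * (\<alpha> * x powr (\<alpha> - 1) * (- sin \<eta>) * D powr (- (1 + \<alpha>)) +
              x powr \<alpha> * (- (1 + \<alpha>) * D powr (- (1 + \<alpha>) - 1) * (c * sin \<eta>)))) (at \<eta>)"
      unfolding x_def D_def
      by (rule DERIV_cong[OF DERIV_mult[OF DERIV_sin DERIV_mult[OF dx dD]]])
        (simp add: algebra_simps)
    also have "x * (x powr \<alpha> * D powr (- (1 + \<alpha>))) +
            sin \<eta> * (\<alpha> * x powr (\<alpha> - 1) * (- sin \<eta>) * D powr (- (1 + \<alpha>)) +
              x powr \<alpha> * (- (1 + \<alpha>) * D powr (- (1 + \<alpha>) - 1) * (c * sin \<eta>))) =
            x * (A * x * (B * D)) - (sin \<eta> * sin \<eta>) * (\<alpha> * A * (B * D) + A * x * ((1 + \<alpha>) * B * c))"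
    proof -
      have "D powr (- (1 + \<alpha>)) = B * D" "D powr (- (1 + \<alpha>) - 1) = B"
        by (simp only: powr_minus_divide B) (simp add: B_def algebra_simps)
      then show ?thesis
        unfolding A A_def[symmetric] by (simp only:) (simp add: algebra_simps)
    qed
    \<comment> \<open>With the squared sine and \<open>D\<close> written in terms of
      \<open>x\<close>, this is a polynomial identity times \<open>A * B\<close>.\<close>
    also have "\<dots> = ?g \<eta>"
      unfolding r s D_def by (simp add: power2_eq_square algebra_simps)
    finally show "((\<lambda>\<eta>. sin \<eta> * relu_integrand \<alpha> c \<eta>) has_vector_derivative ?g \<eta>) (at \<eta>)"
      unfolding has_real_derivative_iff_has_vector_derivative[symmetric] relu_integrand_def
        powr_minus_divide by simp
  qed simp
  then have g: "(?g has_integral 0) {0..pi / 2}"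
    by (simp add: relu_integrand_def)
  have f: "(?f has_integral ((1 + \<alpha>) * (1 - c\<^sup>2) * relu_integral (\<alpha> + 1) c -
             (2 * \<alpha> + 1) * c * relu_integral \<alpha> c)) {0..pi / 2}"
    unfolding relu_integral_def using assms
    by (intro has_integral_diff has_integral_mult_right integrable_integral
        relu_integrand_integrable) auto
  \<comment> \<open>Integrability of the singular integrand is a by-product of the subtraction: both
    \<open>?f\<close> and \<open>?g\<close> have integrals.\<close>
  have "((\<lambda>\<eta>. \<alpha> * relu_integrand (\<alpha> - 1) c \<eta>) has_integral
          ((1 + \<alpha>) * (1 - c\<^sup>2) * relu_integral (\<alpha> + 1) c -
             (2 * \<alpha> + 1) * c * relu_integral \<alpha> c)) {0..pi / 2}"
    using has_integral_diff[OF f g] by simp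
  then show ?thesis
    unfolding relu_integral_def by (simp add: integral_unique flip: integral_mult_right)
qed

section \<open>Derivatives of both kernels, free of the factor
  \<open>2 * \<alpha> - 1\<close>\<close>

lemma relu_JJ_eq:
  assumes "-1 < c" "c < 1"
  shows "relu_JJ \<alpha> c = relu_factor \<alpha> * (1 - c\<^sup>2) powr (\<alpha> + 1 / 2) * relu_integral \<alpha> c"
proof -
  have "sin (arccos c) = (1 - c\<^sup>2) powr (1 / 2)"
    using assms one_minus_square_pos[OF assms] by (simp add: sin_arccos powr_half_sqrt)
  then have "sin (arccos c) powr (2 * \<alpha> + 1) = (1 - c\<^sup>2) powr (\<alpha> + 1 / 2)"
    by (simp add: powr_powr field_simps)
  then show ?thesis
    using assms
    by (simp add: relu_JJ_def relu_J_def relu_factor_def relu_integral_def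
        relu_integrand_def[abs_def])
qed

text \<open>By the product rule, the power of \<open>1 - c\<^sup>2\<close> contributes
  \<open>- (2 * \<alpha> + 1) * c * relu_integral \<alpha> c\<close> and the integral contributes
  the term with \<open>\<alpha> + 1\<close>. Their sum is the right-hand side of the
  recurrence.\<close>

lemma relu_JJ_has_derivative:
  assumes "0 < \<alpha>" "-1 < c" "c < 1"
  shows "(relu_JJ \<alpha> has_real_derivative relu_JJ_deriv \<alpha> c) (at c)"
proof -
  let ?p = "(1 - c\<^sup>2) powr (\<alpha> - 1 / 2)"
  have pos: "0 < 1 - c\<^sup>2" using assms by (intro one_minus_square_pos)
  have p: "(1 - c\<^sup>2) powr (\<alpha> + 1 / 2) = ?p * (1 - c\<^sup>2)"
    using powr_add[of "1 - c\<^sup>2" "\<alpha> - 1 / 2" 1] pos by (simp add: add.commute)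
  have "((\<lambda>c. 1 - c\<^sup>2) has_real_derivative - 2 * c) (at c)"
    by (auto intro!: derivative_eq_intros)
  from DERIV_fun_powr[OF this pos]
  have "((\<lambda>c. (1 - c\<^sup>2) powr (\<alpha> + 1 / 2)) has_real_derivative
          (\<alpha> + 1 / 2) * ?p * (- 2 * c)) (at c)"
    by (rule DERIV_cong) (simp add: algebra_simps)
  from DERIV_mult[OF this relu_integral_has_derivative[OF assms]]
  have "((\<lambda>c. relu_factor \<alpha> * ((1 - c\<^sup>2) powr (\<alpha> + 1 / 2) * relu_integral \<alpha> c)) has_real_derivative
          relu_JJ_deriv \<alpha> c) (at c)"
    unfolding relu_JJ_deriv_def relu_integral_recurrence[OF assms]
    by (rule DERIV_cong[OF DERIV_cmult]) (simp add: p algebra_simps)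
  \<comment> \<open>The product formula for \<open>relu_JJ\<close> holds on the open interval, hence
    near \<open>c\<close>, which suffices to transfer the derivative.\<close>
  moreover have ev: "\<forall>\<^sub>F c in nhds c. relu_JJ \<alpha> c =
      relu_factor \<alpha> * ((1 - c\<^sup>2) powr (\<alpha> + 1 / 2) * relu_integral \<alpha> c)"
    using eventually_nhds_in_open[of "{-1<..<1}" c] assms
    by (auto elim!: eventually_mono simp: relu_JJ_eq)
  ultimately show ?thesis
    using DERIV_cong_ev[OF refl ev refl] by simp
qed

lemma relu_J_eq_relu_JJ_cos:
  assumes "\<theta> \<in> {0<..<pi}"
  shows "relu_J \<alpha> \<theta> = relu_JJ \<alpha> (cos \<theta>)"
  using assms by (simp add: relu_JJ_def arccos_cos)

lemma cos_strict_bounds: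
  assumes "\<theta> \<in> {0<..<pi}"
  shows "-1 < cos \<theta>" "cos \<theta> < 1"
  using assms cos_monotone_0_pi[of 0 \<theta>] cos_monotone_0_pi[of \<theta> pi] by auto

lemma relu_J_has_derivative:
  assumes "0 < \<alpha>" "\<theta> \<in> {0<..<pi}"
  shows "(relu_J \<alpha> has_real_derivative - relu_JJ_deriv \<alpha> (cos \<theta>) * sin \<theta>) (at \<theta>)"
proof -
  have "((\<lambda>\<theta>. relu_JJ \<alpha> (cos \<theta>)) has_real_derivative
          relu_JJ_deriv \<alpha> (cos \<theta>) * - sin \<theta>) (at \<theta>)"
    using DERIV_chain2[OF relu_JJ_has_derivative DERIV_cos] assms cos_strict_bounds by blast
  moreover have ev: "\<forall>\<^sub>F \<theta> in nhds \<theta>. relu_J \<alpha> \<theta> = relu_JJ \<alpha> (cos \<theta>)"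
    using eventually_nhds_in_open[of "{0<..<pi}" \<theta>] assms
    by (auto elim!: eventually_mono simp: relu_J_eq_relu_JJ_cos)
  ultimately show ?thesis
    using DERIV_cong_ev[OF refl ev refl] by simp
qed

section \<open>The normalising constant and the factor \<open>2 * \<alpha> - 1\<close>\<close>

lemma relu_const_rec:
  assumes "0 < \<alpha>" "\<alpha> \<noteq> 1 / 2"
  shows "relu_const \<alpha> = (2 * \<alpha> - 1) * relu_const (\<alpha> - 1)"
proof -
  \<comment> \<open>Since \<open>\<alpha> - 1 / 2 > - 1 / 2\<close>, the only pole of
    \<open>Gamma\<close> to avoid is 0, that is \<open>\<alpha> = 1 / 2\<close>.\<close>
  have "\<alpha> - 1 / 2 \<notin> \<int>\<^sub>\<le>\<^sub>0"
    using assms by (auto elim!: nonpos_Ints_cases simp: field_simps)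
  then have "Gamma (\<alpha> + 1 / 2) = (\<alpha> - 1 / 2) * Gamma (\<alpha> - 1 / 2)"
    using Gamma_plus1[of "\<alpha> - 1 / 2"] by (simp add: algebra_simps)
  moreover have "2 powr (\<alpha> - 1) = 2 * (2 :: real) powr (\<alpha> - 2)"
    using powr_add[of 2 1 "\<alpha> - 2"] by simp
  ultimately show ?thesis
    by (simp add: relu_const_def)
qed

text \<open>One factor \<alpha> comes from the recurrence for the integral, the other from
  \<open>Gamma (\<alpha> + 1) = \<alpha> * Gamma \<alpha>\<close>; the quotient of the constants
  gives the inverse of \<open>2 * \<alpha> - 1\<close>.\<close>

lemma relu_JJ_deriv_eq:
  assumes "0 < \<alpha>" "\<alpha> \<noteq> 1 / 2" "-1 < c" "c < 1"
  shows "relu_JJ_deriv \<alpha> c = \<alpha>\<^sup>2 * inverse (2 * \<alpha> - 1) * relu_JJ (\<alpha> - 1) c"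
proof -
  have "Gamma (\<alpha> + 1) = \<alpha> * Gamma \<alpha>"
    using assms by (intro Gamma_plus1) auto
  moreover have "2 * \<alpha> - 1 \<noteq> 0" using assms by simp
  ultimately have "relu_factor \<alpha> * \<alpha> = \<alpha>\<^sup>2 * inverse (2 * \<alpha> - 1) * relu_factor (\<alpha> - 1)"
    unfolding relu_factor_def relu_const_rec[OF assms(1,2)]
    by (simp add: power2_eq_square divide_simps)
  then show ?thesis
    using assms by (simp add: relu_JJ_deriv_def relu_JJ_eq algebra_simps)
qed

section \<open>Continuity in the exponent and the exceptional case
  \<open>\<alpha> = 1 / 2\<close>\<close>

lemma tendsto_relu_integral:
  assumes "0 < \<alpha>" "-1 < c" "c < 1"
  shows "((\<lambda>\<beta>. relu_integral \<beta> c) \<longlongrightarrow> relu_integral \<alpha> c) (at \<alpha>)"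
proof -
  have "continuous_on {0<..} (\<lambda>\<beta>. integral (cbox 0 (pi / 2)) (relu_integrand \<beta> c))"
    using assms
    by (intro integral_continuous_on_param) (auto simp: case_prod_unfold intro!: continuous_intros)
  then show ?thesis
    using assms by (simp add: continuous_on_eq_continuous_at isCont_def relu_integral_def)
qed

lemma tendsto_relu_factor:
  assumes "0 < \<alpha>"
  shows "(relu_factor \<longlongrightarrow> relu_factor \<alpha>) (at \<alpha>)"
proof -
  have "Gamma (\<alpha> + 1 / 2) > 0" using assms by (intro Gamma_real_pos) auto
  moreover have "\<alpha> + 1 / 2 \<notin> \<int>\<^sub>\<le>\<^sub>0" "\<alpha> + 1 \<notin> \<int>\<^sub>\<le>\<^sub>0"
    using assms by (auto elim!: nonpos_Ints_cases)
  ultimately show ?thesis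
    unfolding relu_factor_def relu_const_def by (intro tendsto_intros) auto
qed

text \<open>The integral with exponent \<open>\<beta> - 1\<close> may be singular, so the limit is
  taken in the form \<open>?R\<close>, whose integrals have the positive exponents
  \<open>\<beta>\<close> and \<open>\<beta> + 1\<close>.\<close>

lemma tendsto_relu_JJ_deriv:
  assumes "0 < \<alpha>" "-1 < c" "c < 1"
  shows "((\<lambda>\<beta>. relu_JJ_deriv \<beta> c) \<longlongrightarrow> relu_JJ_deriv \<alpha> c) (at \<alpha>)"
proof -
  let ?R = "\<lambda>\<beta>. relu_factor \<beta> * (1 - c\<^sup>2) powr (\<beta> - 1 / 2) *
    ((1 + \<beta>) * (1 - c\<^sup>2) * relu_integral (\<beta> + 1) c - (2 * \<beta> + 1) * c * relu_integral \<beta> c)"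
  have eq: "relu_JJ_deriv \<beta> c = ?R \<beta>" if "0 < \<beta>" for \<beta>
    unfolding relu_JJ_deriv_def relu_integral_recurrence[OF that assms(2,3)] ..
  have "((\<lambda>\<beta>. relu_integral (\<beta> + 1) c) \<longlongrightarrow> relu_integral (\<alpha> + 1) c) (at \<alpha>)"
    using LIM_offset[OF tendsto_relu_integral[of "\<alpha> + 1" c], of 1] assms by simp
  then have "(?R \<longlongrightarrow> ?R \<alpha>) (at \<alpha>)"
    using assms one_minus_square_pos[of c]
    by (intro tendsto_intros tendsto_relu_factor tendsto_relu_integral) auto
  moreover have "\<forall>\<^sub>F \<beta> in at \<alpha>. 0 < \<beta>"
    using assms(1) by (rule order_tendstoD(1)[OF tendsto_ident_at])
  then have "\<forall>\<^sub>F \<beta> in at \<alpha>. ?R \<beta> = relu_JJ_deriv \<beta> c"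
    by eventually_elim (simp only: eq)
  ultimately show ?thesis
    unfolding eq[OF assms(1)] by (rule Lim_transform_eventually)
qed

lemma tendsto_relu_JJ_scaled:
  assumes "0 < \<alpha>" "-1 < c" "c < 1"
  shows "((\<lambda>\<beta>. \<beta>\<^sup>2 * inverse (2 * \<beta> - 1) * relu_JJ (\<beta> - 1) c) \<longlongrightarrow> relu_JJ_deriv \<alpha> c) (at \<alpha>)"
proof -
  have "\<forall>\<^sub>F \<beta> in at \<alpha>. 0 < \<beta>"
    using assms(1) by (rule order_tendstoD(1)[OF tendsto_ident_at])
  \<comment> \<open>The filter \<open>at \<alpha>\<close> omits \<alpha> itself, so this holds for
    \<open>\<alpha> = 1 / 2\<close> too and the junk value there never enters.\<close>
  moreover have "\<forall>\<^sub>F \<beta> in at \<alpha>. \<beta> \<noteq> 1 / 2"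
    by (rule eventually_neq_at_within)
  ultimately have "\<forall>\<^sub>F \<beta> in at \<alpha>.
      relu_JJ_deriv \<beta> c = \<beta>\<^sup>2 * inverse (2 * \<beta> - 1) * relu_JJ (\<beta> - 1) c"
    by eventually_elim (use assms in \<open>simp add: relu_JJ_deriv_eq\<close>)
  then show ?thesis
    by (rule Lim_transform_eventually[OF tendsto_relu_JJ_deriv[OF assms]])
qed

text \<open>At \<open>\<alpha> = 1 / 2\<close> the formula is formally infinity times 0, and its
  literal value would be 0 because \<open>inverse 0 = 0\<close>. The derivative is therefore
  identified there as the limit of the formula as the exponent tends to
  \<open>1 / 2\<close>.\<close>

theorem lemmaC34:
  fixes \<alpha> :: real
  assumes "\<alpha> > 0"
  shows
    "(\<alpha> \<noteq> 1 / 2 \<longrightarrow>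
       (\<forall>\<theta>\<in>{0<..<pi}.
          (relu_J \<alpha> has_real_derivative
             - (\<alpha>\<^sup>2) * inverse (2 * \<alpha> - 1) * relu_J (\<alpha> - 1) \<theta> * sin \<theta>) (at \<theta>)) \<and>
       (\<forall>c\<in>{-1<..<1}.
          (relu_JJ \<alpha> has_real_derivative
             \<alpha>\<^sup>2 * inverse (2 * \<alpha> - 1) * relu_JJ (\<alpha> - 1) c) (at c))) \<and>
     (\<alpha> = 1 / 2 \<longrightarrow>
       (\<forall>\<theta>\<in>{0<..<pi}. \<exists>D.
          ((\<lambda>\<beta>. - (\<beta>\<^sup>2) * inverse (2 * \<beta> - 1) * relu_J (\<beta> - 1) \<theta> * sin \<theta>) \<longlongrightarrow> D) (at \<alpha>) \<and>
          (relu_J \<alpha> has_real_derivative D) (at \<theta>)) \<and>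
       (\<forall>c\<in>{-1<..<1}. \<exists>D.
          ((\<lambda>\<beta>. \<beta>\<^sup>2 * inverse (2 * \<beta> - 1) * relu_JJ (\<beta> - 1) c) \<longlongrightarrow> D) (at \<alpha>) \<and>
          (relu_JJ \<alpha> has_real_derivative D) (at c)))"
proof (intro conjI impI ballI)
  fix \<theta> :: real assume "\<alpha> \<noteq> 1 / 2" and \<theta>: "\<theta> \<in> {0<..<pi}"
  then show "(relu_J \<alpha> has_real_derivative
      - (\<alpha>\<^sup>2) * inverse (2 * \<alpha> - 1) * relu_J (\<alpha> - 1) \<theta> * sin \<theta>) (at \<theta>)"
    using relu_J_has_derivative[OF assms \<theta>] relu_JJ_deriv_eq[OF assms _ cos_strict_bounds[OF \<theta>]]
    by (simp add: relu_J_eq_relu_JJ_cos)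
next
  fix c :: real assume "\<alpha> \<noteq> 1 / 2" and "c \<in> {-1<..<1}"
  then show "(relu_JJ \<alpha> has_real_derivative
      \<alpha>\<^sup>2 * inverse (2 * \<alpha> - 1) * relu_JJ (\<alpha> - 1) c) (at c)"
    using relu_JJ_has_derivative[OF assms] relu_JJ_deriv_eq[OF assms] by simp
next
  fix \<theta> :: real assume \<theta>: "\<theta> \<in> {0<..<pi}"
  \<comment> \<open>The limit found here is the witness for \<open>D\<close>: it is the derivative
    given by \<open>relu_J_has_derivative\<close>.\<close>
  have "((\<lambda>\<beta>. - (\<beta>\<^sup>2 * inverse (2 * \<beta> - 1) * relu_JJ (\<beta> - 1) (cos \<theta>)) * sin \<theta>) \<longlongrightarrow>
          - relu_JJ_deriv \<alpha> (cos \<theta>) * sin \<theta>) (at \<alpha>)"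
    by (intro tendsto_intros tendsto_relu_JJ_scaled assms cos_strict_bounds \<theta>)
  then show "\<exists>D.
      ((\<lambda>\<beta>. - (\<beta>\<^sup>2) * inverse (2 * \<beta> - 1) * relu_J (\<beta> - 1) \<theta> * sin \<theta>) \<longlongrightarrow> D) (at \<alpha>) \<and>
      (relu_J \<alpha> has_real_derivative D) (at \<theta>)"
    using relu_J_has_derivative[OF assms \<theta>] by (auto simp: relu_J_eq_relu_JJ_cos[OF \<theta>])
next
  fix c :: real assume "c \<in> {-1<..<1}"
  then show "\<exists>D.
      ((\<lambda>\<beta>. \<beta>\<^sup>2 * inverse (2 * \<beta> - 1) * relu_JJ (\<beta> - 1) c) \<longlongrightarrow> D) (at \<alpha>) \<and>
      (relu_JJ \<alpha> has_real_derivative D) (at c)"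
    using tendsto_relu_JJ_scaled[OF assms] relu_JJ_has_derivative[OF assms] by auto
qed

end
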